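(* Let $(V,R)$ be an irreducible root system with Weyl group $W$, and let $\mu\in V^*$ be non-zero. Then the convex hull of the finite set $\{w\mu\mid w\in W\}$ contains an open neighborhood of the origin.
   Context: $V$ is a finite-dimensional real vector space spanned by the root system $R$, $V^*$ is its dual with the dual action of $W$, and the open neighborhood is taken in $V^*$. *)

theory Defs
  imports "HOL-Analysis.Analysis"
begin

definition reflection :: "'a::real_vector \<Rightarrow> ('a \<Rightarrow> real) \<Rightarrow> 'a \<Rightarrow> 'a" where
  "reflection \<alpha> f x = x - f x *\<^sub>R \<alpha>"

text \<open>
  A coroot of \<open>\<alpha>\<close> is a linear functional \<open>f\<close> with \<open>f \<alpha> = 2\<close> whose reflection maps the finite set
  \<open>R\<close> into (hence onto) itself. If \<open>R\<close> spans the whole type, it is uniquely determined by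
  \<open>R\<close> and \<open>\<alpha>\<close>. If \<open>R\<close> only spans a subspace \<open>V\<close>, only the restriction of \<open>f\<close> to \<open>V\<close> is
  determined; since every functional on \<open>V\<close> extends linearly, existence of such an \<open>f\<close> on the
  whole type is the same as existence of a coroot in the dual of \<open>V\<close>.
\<close>

definition is_coroot :: "'a::real_vector set \<Rightarrow> 'a \<Rightarrow> ('a \<Rightarrow> real) \<Rightarrow> bool" where
  "is_coroot R \<alpha> f \<longleftrightarrow> linear f \<and> f \<alpha> = 2 \<and> reflection \<alpha> f ` R \<subseteq> R"

text \<open>
  Root systems in the sense of Bourbaki: crystallographic, not necessarily reduced, with no inner
  product fixed. The space \<open>V\<close> is a subspace of the ambient type, so that summands of a
  decomposition are root systems too; it is finite-dimensional because it is spanned by the finite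
  set \<open>R\<close>.
\<close>

definition root_system :: "'a::real_vector set \<Rightarrow> 'a set \<Rightarrow> bool" where
  "root_system V R \<longleftrightarrow>
     subspace V \<and> finite R \<and> 0 \<notin> R \<and> span R = V \<and>
     (\<forall>\<alpha>\<in>R. \<exists>f. is_coroot R \<alpha> f \<and> f ` R \<subseteq> \<int>)"

definition irreducible_root_system :: "'a::real_vector set \<Rightarrow> 'a set \<Rightarrow> bool" where
  "irreducible_root_system V R \<longleftrightarrow>
     root_system V R \<and> R \<noteq> {} \<and>
     \<not> (\<exists>V1 V2 R1 R2.
          root_system V1 R1 \<and> root_system V2 R2 \<and> R1 \<noteq> {} \<and> R2 \<noteq> {} \<and>
          V = {x + y | x y. x \<in> V1 \<and> y \<in> V2} \<and> V1 \<inter> V2 = {0} \<and>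
          R = R1 \<union> R2)"

text \<open>The group generated by the reflections, for a root system spanning the whole type.\<close>

inductive_set weyl_group :: "'a::real_vector set \<Rightarrow> ('a \<Rightarrow> 'a) set" for R where
  id: "id \<in> weyl_group R"
| reflection: "\<alpha> \<in> R \<Longrightarrow> is_coroot R \<alpha> f \<Longrightarrow> reflection \<alpha> f \<in> weyl_group R"
| comp: "v \<in> weyl_group R \<Longrightarrow> w \<in> weyl_group R \<Longrightarrow> v \<circ> w \<in> weyl_group R"
| inverse: "w \<in> weyl_group R \<Longrightarrow> inv w \<in> weyl_group R"

text \<open>
  On a Euclidean space every linear functional is bounded, so the type of bounded linear
  functionals is the full dual, and its operator-norm topology is the canonical topology of a
  finite-dimensional space. For linear \<open>w\<close> the argument of \<open>Blinfun\<close> is bounded linear.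
\<close>

definition dual_action ::
    "('a::euclidean_space \<Rightarrow> 'a) \<Rightarrow> ('a \<Rightarrow>\<^sub>L real) \<Rightarrow> ('a \<Rightarrow>\<^sub>L real)" where
  "dual_action w \<mu> = Blinfun (\<lambda>x. blinfun_apply \<mu> (inv w x))"

end

theory Submission imports Defs begin

text \<open>
  Suppose that the origin is not interior to the convex hull of the orbit of \<open>\<mu>\<close>. A separating
  hyperplane in \<open>V\<^sup>*\<close> is a non-zero vector \<open>x \<in> V\<close> with \<open>(w \<mu>)(x) \<ge> 0\<close> for every \<open>w \<in> W\<close>, that
  is, \<open>\<mu> (w x) \<ge> 0\<close> for every \<open>w\<close>. But \<open>\<Sum>\<^sub>w w x = 0\<close>: the sum over \<open>W\<close> does not change when \<open>w\<close> is
  replaced by \<open>w s\<^sub>\<alpha>\<close>, so it takes the same value at \<open>\<alpha>\<close> and \<open>-\<alpha>\<close>, hence vanishes on every root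
  and so everywhere (\<open>sum_vanishes_on_span\<close>). Non-negative numbers with sum zero are zero, so \<open>x\<close>
  lies in the \<open>W\<close>-invariant subspace \<open>K = {x. \<forall>w\<in>W. \<mu> (w x) = 0}\<close>. This subspace is proper because
  \<open>\<mu> \<noteq> 0\<close>, and it contains \<open>x \<noteq> 0\<close>.

  It remains that \<open>V\<close> is irreducible as a representation of \<open>W\<close> (\<open>invariant_subspace_trivial\<close>).
  A reflection \<open>s\<^sub>\<alpha>\<close> preserving \<open>K\<close> has either \<open>\<alpha> \<in> K\<close> or fixes \<open>K\<close> pointwise, so a non-trivial \<open>K\<close>
  would split \<open>R\<close> into \<open>R \<inter> K\<close> and \<open>R - K\<close>. Their spans meet only in \<open>0\<close>, by the same summation
  trick for the pointwise stabiliser of \<open>K\<close>: the sum over this group kills the span of \<open>R - K\<close>, and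
  is multiplication by the order of the group on \<open>K\<close>.
\<close>

section \<open>The Weyl group as a finite group of permutations of the roots\<close>

lemma linear_reflection: "linear f \<Longrightarrow> linear (reflection \<alpha> f)"
  by (rule linearI) (simp_all add: reflection_def linear_add linear_scale algebra_simps)

lemma reflection_involution:
  assumes "linear f" "f \<alpha> = 2"
  shows "reflection \<alpha> f \<circ> reflection \<alpha> f = id"
  using assms by (auto simp: fun_eq_iff reflection_def linear_diff linear_scale scaleR_2
      algebra_simps)

lemma reflection_root:
  assumes "f \<alpha> = 2"
  shows "reflection \<alpha> f \<alpha> = - \<alpha>"
  using assms by (simp add: reflection_def scaleR_2)

lemma weyl_group_element:
  fixes R :: "'a::real_vector set"
  assumes "finite R" "w \<in> weyl_group R"
  shows "linear w \<and> bij w \<and> w ` R = R"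
  using assms(2)
proof induction
  case id
  show ?case using linear_id by (metis bij_id image_id id_apply)
next
  case (reflection \<alpha> f)
  then have f: "linear f" "f \<alpha> = 2" "Defs.reflection \<alpha> f ` R \<subseteq> R"
    by (auto simp: is_coroot_def)
  have "bij (Defs.reflection \<alpha> f)"
    using reflection_involution[OF f(1,2)] o_bij by blast
  moreover from this have "Defs.reflection \<alpha> f ` R = R"
    using f(3) assms(1) by (metis bij_is_inj endo_inj_surj inj_on_subset subset_UNIV)
  ultimately show ?case using f linear_reflection by blast
next
  case (comp v w)
  then show ?case
    using linear_compose[of w v] bij_comp[of w v] image_comp[of v w R] by metis
next
  case (inverse w)
  then have w: "linear w" "inj w" "surj w" by (auto simp: bij_is_inj bij_is_surj)
  have "linear (inv w)"
    by (rule linearI; rule inv_f_eq[OF w(2)])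
       (simp_all add: linear_add[OF w(1)] linear_scale[OF w(1)] surj_f_inv_f[OF w(3)])
  moreover have "inv w ` R = R"
    using inverse by (metis bij_is_inj image_inv_f_f)
  ultimately show ?case using inverse bij_imp_bij_inv by blast
qed

text \<open>
  An element of the Weyl group is determined by the permutation it induces on the spanning set
  of roots.
\<close>

lemma finite_weyl_group:
  fixes R :: "'a::real_vector set"
  assumes "finite R" "span R = UNIV"
  shows "finite (weyl_group R)"
proof (rule finite_imageD)
  have "(\<lambda>w. restrict w R) ` weyl_group R \<subseteq> PiE R (\<lambda>_. R)"
    using weyl_group_element[OF assms(1)] by fastforce
  then show "finite ((\<lambda>w. restrict w R) ` weyl_group R)"
    using assms(1) by (meson finite_PiE finite_subset)
  show "inj_on (\<lambda>w. restrict w R) (weyl_group R)"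
  proof (rule inj_onI)
    fix v w assume vw: "v \<in> weyl_group R" "w \<in> weyl_group R" "restrict v R = restrict w R"
    show "v = w"
    proof
      fix x
      have "v \<alpha> = w \<alpha>" if "\<alpha> \<in> R" for \<alpha>
        using that vw(3) by (metis restrict_apply')
      then show "v x = w x"
        using weyl_group_element[OF assms(1)] vw(1,2) linear_eq_on_span[of v w R x] assms(2)
        by auto
    qed
  qed
qed

section \<open>Irreducibility of the reflection representation\<close>

text \<open>
  Right multiplication by the involution \<open>s\<close> permutes \<open>G\<close>, so the sum over \<open>G\<close> takes equal values
  at \<open>\<alpha>\<close> and at \<open>s \<alpha> = - \<alpha>\<close>.
\<close>

lemma eq_uminus_self_imp_zero:
  fixes x :: "'a::real_vector"
  assumes "x = - x"
  shows "x = 0"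
proof -
  have "2 *\<^sub>R x = 0" using assms by (metis add.right_inverse scaleR_2)
  then show ?thesis by simp
qed

lemma sum_vanishes_on_span:
  fixes G :: "('a::real_vector \<Rightarrow> 'a) set"
  assumes lin: "\<And>w. w \<in> G \<Longrightarrow> linear w"
    and refl: "\<And>\<alpha>. \<alpha> \<in> S \<Longrightarrow> \<exists>s. s \<circ> s = id \<and> s \<alpha> = - \<alpha> \<and> (\<forall>w\<in>G. w \<circ> s \<in> G)"
    and x: "x \<in> span S"
  shows "(\<Sum>w\<in>G. w x) = 0"
proof (rule linear_eq_0_on_span[OF _ _ x])
  show "linear (\<lambda>x. \<Sum>w\<in>G. w x)"
    using lin by (intro linear_compose_sum) auto
next
  fix \<alpha> assume "\<alpha> \<in> S"
  then obtain s where s: "s \<circ> s = id" "s \<alpha> = - \<alpha>" "\<And>w. w \<in> G \<Longrightarrow> w \<circ> s \<in> G"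
    using refl by blast
  have ss: "s (s x) = x" for x using s(1) by (metis comp_apply id_apply)
  have "(\<Sum>w\<in>G. w \<alpha>) = (\<Sum>w\<in>G. (w \<circ> s) \<alpha>)"
    by (rule sum.reindex_bij_witness[where i = "\<lambda>w. w \<circ> s" and j = "\<lambda>w. w \<circ> s"])
       (use s ss in \<open>auto simp: comp_assoc\<close>)
  also have "\<dots> = (\<Sum>w\<in>G. - w \<alpha>)"
    using lin by (intro sum.cong) (auto simp: s linear_neg)
  finally show "(\<Sum>w\<in>G. w \<alpha>) = 0"
    using eq_uminus_self_imp_zero[of "\<Sum>w\<in>G. w \<alpha>"] by (simp add: sum_negf)
qed

text \<open>
  Reflections map \<open>K\<close> to itself and, being involutions, also its complement. So a coroot of a
  root for \<open>R\<close> is a coroot for whichever of the two parts contains the root.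
\<close>

lemma root_system_split_by_invariant_subspace:
  fixes R :: "'a::real_vector set"
  assumes R: "root_system UNIV R"
    and K: "subspace K" "\<And>w. w \<in> weyl_group R \<Longrightarrow> w ` K \<subseteq> K"
  shows "root_system (span (R \<inter> K)) (R \<inter> K)" "root_system (span (R - K)) (R - K)"
proof -
  have fin: "finite R" and R0: "0 \<notin> R"
    and ex: "\<And>\<alpha>. \<alpha> \<in> R \<Longrightarrow> \<exists>f. is_coroot R \<alpha> f \<and> f ` R \<subseteq> \<int>"
    using R by (auto simp: root_system_def)
  have "\<exists>f. (is_coroot (R \<inter> K) \<alpha> f \<and> f ` (R \<inter> K) \<subseteq> \<int>) \<and>
      (is_coroot (R - K) \<alpha> f \<and> f ` (R - K) \<subseteq> \<int>)"
    if \<alpha>: "\<alpha> \<in> R" for \<alpha>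
  proof -
    obtain f where f: "is_coroot R \<alpha> f" "f ` R \<subseteq> \<int>" using ex[OF \<alpha>] by blast
    let ?s = "reflection \<alpha> f"
    have f': "linear f" "f \<alpha> = 2" "?s ` R \<subseteq> R" using f(1) by (auto simp: is_coroot_def)
    have sK: "?s ` K \<subseteq> K" using K(2) weyl_group.reflection[OF \<alpha> f(1)] by blast
    have ss: "?s (?s x) = x" for x
      using reflection_involution[OF f'(1,2)] by (metis comp_apply id_apply)
    have "?s ` (R \<inter> K) \<subseteq> R \<inter> K" using f'(3) sK by blast
    moreover have "?s \<beta> \<notin> K" if "\<beta> \<notin> K" for \<beta>
      using that sK ss[of \<beta>] by (metis image_subset_iff)
    then have "?s ` (R - K) \<subseteq> R - K" using f'(3) by blast
    moreover have "f ` (R \<inter> K) \<subseteq> \<int>" "f ` (R - K) \<subseteq> \<int>" using f(2) by blast+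
    ultimately show ?thesis using f' unfolding is_coroot_def by blast
  qed
  then have "\<forall>\<alpha>\<in>R \<inter> K. \<exists>f. is_coroot (R \<inter> K) \<alpha> f \<and> f ` (R \<inter> K) \<subseteq> \<int>"
    and "\<forall>\<alpha>\<in>R - K. \<exists>f. is_coroot (R - K) \<alpha> f \<and> f ` (R - K) \<subseteq> \<int>"
    by blast+
  then show "root_system (span (R \<inter> K)) (R \<inter> K)" "root_system (span (R - K)) (R - K)"
    using fin R0 by (simp_all add: root_system_def)
qed

text \<open>
  If \<open>\<alpha> \<notin> K\<close>, then \<open>s\<^sub>\<alpha> x - x\<close> is a multiple of \<open>\<alpha>\<close> lying in \<open>K\<close> for every \<open>x \<in> K\<close>, hence
  zero, and \<open>s\<^sub>\<alpha>\<close> belongs to the pointwise stabiliser of \<open>K\<close>. The sum over the stabiliser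
  therefore kills \<open>span (R - K)\<close>, while it multiplies vectors of \<open>K\<close> by a positive integer.
\<close>

lemma invariant_subspace_Int_span_other_roots:
  fixes R :: "'a::real_vector set"
  assumes R: "root_system UNIV R"
    and K: "subspace K" "\<And>w. w \<in> weyl_group R \<Longrightarrow> w ` K \<subseteq> K"
  shows "K \<inter> span (R - K) = {0}"
proof -
  have fin: "finite R" and span: "span R = UNIV"
    and ex: "\<And>\<alpha>. \<alpha> \<in> R \<Longrightarrow> \<exists>f. is_coroot R \<alpha> f"
    using R by (auto simp: root_system_def)
  define G where "G = {w \<in> weyl_group R. \<forall>x\<in>K. w x = x}"
  have finG: "finite G" using finite_weyl_group[OF fin span] by (simp add: G_def)
  have idG: "id \<in> G" by (simp add: G_def weyl_group.id)
  have "\<exists>s. s \<circ> s = id \<and> s \<alpha> = - \<alpha> \<and> (\<forall>w\<in>G. w \<circ> s \<in> G)" if \<alpha>: "\<alpha> \<in> R - K" for \<alpha>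
  proof -
    obtain f where f: "is_coroot R \<alpha> f" using ex \<alpha> by blast
    let ?s = "reflection \<alpha> f"
    have f': "linear f" "f \<alpha> = 2" using f by (auto simp: is_coroot_def)
    have sW: "?s \<in> weyl_group R" using weyl_group.reflection f \<alpha> by blast
    have "?s x = x" if x: "x \<in> K" for x
    proof -
      have "x - ?s x \<in> K" using K(1) K(2)[OF sW] x by (blast intro: subspace_diff)
      then have "f x *\<^sub>R \<alpha> \<in> K" by (simp add: reflection_def)
      then have "f x = 0" using \<alpha> K(1) by (metis DiffD2 subspace_scale
            scaleR_scaleR left_inverse scaleR_one)
      then show ?thesis by (simp add: reflection_def)
    qed
    then have "\<forall>w\<in>G. w \<circ> ?s \<in> G" using sW by (auto simp: G_def intro: weyl_group.comp)
    then show ?thesis using reflection_involution[OF f'] reflection_root[of f \<alpha>, OF f'(2)] by blast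
  qed
  then have kill: "(\<Sum>w\<in>G. w x) = 0" if "x \<in> span (R - K)" for x
    using that weyl_group_element[OF fin] by (intro sum_vanishes_on_span) (auto simp: G_def)
  have "x = 0" if x: "x \<in> K" "x \<in> span (R - K)" for x
  proof -
    have "(\<Sum>w\<in>G. w x) = (\<Sum>w\<in>G. x)" using x(1) by (intro sum.cong) (auto simp: G_def)
    then have "real (card G) *\<^sub>R x = 0" using kill[OF x(2)] by (simp add: sum_constant_scaleR)
    then show ?thesis using finG idG by auto
  qed
  then show ?thesis using K(1) by (auto simp: subspace_0 span_zero)
qed

lemma invariant_subspace_trivial:
  fixes R :: "'a::real_vector set"
  assumes irr: "irreducible_root_system UNIV R"
    and K: "subspace K" "\<And>w. w \<in> weyl_group R \<Longrightarrow> w ` K \<subseteq> K"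
  shows "K = {0} \<or> K = UNIV"
proof (rule ccontr)
  assume nontriv: "\<not> (K = {0} \<or> K = UNIV)"
  have R: "root_system UNIV R" using irr by (simp add: irreducible_root_system_def)
  then have span: "span R = UNIV" by (simp add: root_system_def)
  have int: "K \<inter> span (R - K) = {0}"
    by (rule invariant_subspace_Int_span_other_roots[OF R K])
  have RK: "span (R \<inter> K) \<subseteq> K" using K(1) by (simp add: span_minimal)
  have "R \<inter> K \<noteq> {}"
  proof
    assume "R \<inter> K = {}"
    then have "R - K = R" by blast
    then show False using int span nontriv by simp
  qed
  moreover have "R - K \<noteq> {}"
  proof
    assume "R - K = {}"
    then have "R \<inter> K = R" by blast
    then show False using RK span nontriv by auto
  qed
  moreover have "UNIV = {x + y | x y. x \<in> span (R \<inter> K) \<and> y \<in> span (R - K)}"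
    using span_Un[of "R \<inter> K" "R - K"] span by (simp add: Int_Diff_Un)
  moreover have "span (R \<inter> K) \<inter> span (R - K) = {0}"
    using RK int by (auto simp: span_zero)
  moreover have "R = (R \<inter> K) \<union> (R - K)" by blast
  ultimately show False
    using irr root_system_split_by_invariant_subspace[OF R K]
    unfolding irreducible_root_system_def by blast
qed

section \<open>Separation from the origin\<close>

text \<open>
  If \<open>S\<close> has interior points, the hyperplane separating \<open>0\<close> from the interior also bounds its
  closure, which contains \<open>S\<close>. Otherwise \<open>S\<close> lies in a hyperplane, and the sign of the normal
  vector can be chosen.
\<close>

lemma origin_not_interior_imp_halfspace:
  fixes S :: "'a::euclidean_space set"
  assumes "convex S" "0 \<notin> interior S"
  obtains a where "a \<noteq> 0" "\<And>x. x \<in> S \<Longrightarrow> a \<bullet> x \<ge> 0"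
proof (cases "interior S = {}")
  case True
  then obtain a b where ab: "a \<noteq> 0" "S \<subseteq> {x. a \<bullet> x = b}"
    using empty_interior_subset_hyperplane[OF assms(1)] by metis
  show ?thesis
  proof (cases "b \<ge> 0")
    case True
    show ?thesis by (rule that[of a]) (use ab True in auto)
  next
    case False
    show ?thesis by (rule that[of "- a"]) (use ab False in auto)
  qed
next
  case False
  obtain a b where ab: "a \<noteq> 0" "b \<ge> 0" "\<And>x. x \<in> interior S \<Longrightarrow> a \<bullet> x \<ge> b"
    using separating_hyperplane_sets[of "{0}" "interior S"] assms False convex_interior by auto
  have "closure (interior S) \<subseteq> {x. a \<bullet> x \<ge> b}"
    using ab(3) by (intro closure_minimal) (auto simp: closed_halfspace_ge)
  moreover have "S \<subseteq> closure (interior S)"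
    using convex_closure_interior[OF assms(1) False] closure_subset by blast
  ultimately have "a \<bullet> x \<ge> 0" if "x \<in> S" for x
    using that ab(2) by force
  then show ?thesis by (rule that[OF ab(1)])
qed

text \<open>
  The dual is identified with the space itself by \<open>\<phi> \<mapsto> (\<Sum>b\<in>Basis. \<phi> b *\<^sub>R b)\<close>, the Riesz
  representation; pulling back an interior under this continuous linear injection gives an open
  set of functionals.
\<close>

lemma dual_separation:
  fixes S :: "('a::euclidean_space \<Rightarrow>\<^sub>L real) set"
  assumes conv: "convex S"
    and none: "\<not> (\<exists>U. open U \<and> 0 \<in> U \<and> U \<subseteq> S)"
  obtains x where "x \<noteq> 0" "\<And>\<phi>. \<phi> \<in> S \<Longrightarrow> blinfun_apply \<phi> x \<ge> 0"
proof -
  define J :: "('a \<Rightarrow>\<^sub>L real) \<Rightarrow> 'a" where "J = (\<lambda>\<phi>. \<Sum>b\<in>Basis. blinfun_apply \<phi> b *\<^sub>R b)"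
  have J_inner: "x \<bullet> J \<phi> = blinfun_apply \<phi> x" for \<phi> x
  proof -
    have "blinfun_apply \<phi> x = blinfun_apply \<phi> (\<Sum>b\<in>Basis. (x \<bullet> b) *\<^sub>R b)"
      by (simp add: euclidean_representation)
    also have "\<dots> = (\<Sum>b\<in>Basis. (x \<bullet> b) * blinfun_apply \<phi> b)"
      by (simp add: blinfun.sum_right blinfun.scaleR_right)
    finally show ?thesis by (simp add: J_def inner_sum_right mult.commute)
  qed
  have inj: "inj J"
    by (rule injI) (metis J_inner blinfun_eqI)
  have lin: "linear J"
    by (rule linearI) (simp_all add: J_def blinfun.add_left blinfun.scaleR_left
        scaleR_add_left sum.distrib scaleR_sum_right)
  have cont: "continuous_on UNIV J"
    unfolding J_def by (intro continuous_intros)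
  have "0 \<notin> interior (J ` S)"
  proof
    assume "0 \<in> interior (J ` S)"
    moreover have "open (J -` interior (J ` S))"
      by (rule open_vimage[OF open_interior cont])
    moreover have "J -` interior (J ` S) \<subseteq> S"
      using interior_subset[of "J ` S"] inj by (auto dest: injD)
    ultimately show False using none linear_0[OF lin] by auto
  qed
  then obtain a where a: "a \<noteq> 0" "\<And>y. y \<in> J ` S \<Longrightarrow> a \<bullet> y \<ge> 0"
    using origin_not_interior_imp_halfspace convex_linear_image[OF lin conv] by metis
  show ?thesis by (rule that[OF a(1)]) (use a(2) J_inner in \<open>metis imageI\<close>)
qed

section \<open>Convex hulls of orbits in the dual\<close>

lemma blinfun_apply_dual_action:
  fixes R :: "'a::euclidean_space set"
  assumes "finite R" "w \<in> weyl_group R"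
  shows "blinfun_apply (dual_action w \<mu>) x = blinfun_apply \<mu> (inv w x)"
proof -
  have "linear (inv w)"
    using weyl_group_element[OF assms(1) weyl_group.inverse[OF assms(2)]] by blast
  then have "bounded_linear (\<lambda>x. blinfun_apply \<mu> (inv w x))"
    by (simp add: blinfun.bounded_linear_right bounded_linear_compose linear_conv_bounded_linear)
  then show ?thesis by (simp add: dual_action_def bounded_linear_Blinfun_apply)
qed

theorem lemma3p1p11:
  fixes R :: "'a::euclidean_space set" and \<mu> :: "'a \<Rightarrow>\<^sub>L real"
  assumes "irreducible_root_system UNIV R"
    and "\<mu> \<noteq> 0"
  shows "finite {dual_action w \<mu> | w. w \<in> weyl_group R} \<and>
    (\<exists>U. open U \<and> 0 \<in> U \<and> U \<subseteq> convex hull {dual_action w \<mu> | w. w \<in> weyl_group R})"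
proof -
  let ?O = "{dual_action w \<mu> | w. w \<in> weyl_group R}"
  have fin: "finite R" and span: "span R = UNIV"
    and ex: "\<And>\<alpha>. \<alpha> \<in> R \<Longrightarrow> \<exists>f. is_coroot R \<alpha> f"
    using assms(1) by (auto simp: irreducible_root_system_def root_system_def)
  have finW: "finite (weyl_group R)" by (rule finite_weyl_group[OF fin span])
  have lin: "linear w" if "w \<in> weyl_group R" for w
    using weyl_group_element[OF fin that] by blast
  have "\<exists>U. open U \<and> 0 \<in> U \<and> U \<subseteq> convex hull ?O"
  proof (rule ccontr)
    assume "\<not> ?thesis"
    then obtain x where x: "x \<noteq> 0" "\<And>\<phi>. \<phi> \<in> convex hull ?O \<Longrightarrow> blinfun_apply \<phi> x \<ge> 0"
      using dual_separation[OF convex_convex_hull, of ?O] by blast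
    \<comment> \<open>The orbit consists of the functionals \<open>\<mu> \<circ> inv w\<close>, so \<open>\<mu> \<circ> w\<close> is the point coming from \<open>inv w\<close>.\<close>
    have nonneg: "blinfun_apply \<mu> (w x) \<ge> 0" if w: "w \<in> weyl_group R" for w
    proof -
      have "inv (inv w) = w" using weyl_group_element[OF fin w] by (simp add: inv_inv_eq)
      moreover have "dual_action (inv w) \<mu> \<in> convex hull ?O"
        using weyl_group.inverse[OF w] by (intro hull_inc) blast
      ultimately show ?thesis
        using x(2)[of "dual_action (inv w) \<mu>"]
          blinfun_apply_dual_action[OF fin weyl_group.inverse[OF w], of \<mu> x] by simp
    qed
    have "\<exists>s. s \<circ> s = id \<and> s \<alpha> = - \<alpha> \<and> (\<forall>w\<in>weyl_group R. w \<circ> s \<in> weyl_group R)"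
      if \<alpha>: "\<alpha> \<in> R" for \<alpha>
    proof -
      obtain f where f: "is_coroot R \<alpha> f" using ex \<alpha> by blast
      then have "linear f" "f \<alpha> = 2" by (auto simp: is_coroot_def)
      then show ?thesis
        using reflection_involution reflection_root weyl_group.reflection[OF \<alpha> f]
          weyl_group.comp by blast
    qed
    then have "(\<Sum>w\<in>weyl_group R. w x) = 0"
      using lin span by (intro sum_vanishes_on_span[where S = R]) auto
    then have "(\<Sum>w\<in>weyl_group R. blinfun_apply \<mu> (w x)) = 0"
      by (simp add: blinfun.sum_right[symmetric])
    then have zero: "\<forall>w\<in>weyl_group R. blinfun_apply \<mu> (w x) = 0"
      using sum_nonneg_eq_0_iff[OF finW, of "\<lambda>w. blinfun_apply \<mu> (w x)"] nonneg by simp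
    define K where "K = {y. \<forall>w\<in>weyl_group R. blinfun_apply \<mu> (w y) = 0}"
    have "subspace K"
      using lin by (auto simp: subspace_def K_def linear_0 linear_add linear_scale
          blinfun.add_right blinfun.scaleR_right)
    moreover have "w ` K \<subseteq> K" if w: "w \<in> weyl_group R" for w
    proof -
      have "blinfun_apply \<mu> (v (w y)) = 0" if "v \<in> weyl_group R" "y \<in> K" for v y
        using weyl_group.comp[OF that(1) w] that(2) by (force simp: K_def)
      then show ?thesis by (auto simp: K_def)
    qed
    ultimately have "K = {0} \<or> K = UNIV"
      by (rule invariant_subspace_trivial[OF assms(1)])
    moreover have "x \<in> K" using zero by (simp add: K_def)
    ultimately have "K = UNIV" using x(1) by blast
    then have "\<forall>w\<in>weyl_group R. blinfun_apply \<mu> (w y) = 0" for y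
      unfolding K_def by blast
    then have "blinfun_apply \<mu> y = 0" for y
      using weyl_group.id[of R] by fastforce
    then show False using assms(2) by (auto intro: blinfun_eqI)
  qed
  moreover have "?O = (\<lambda>w. dual_action w \<mu>) ` weyl_group R" by blast
  ultimately show ?thesis using finW by simp
qed

end
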